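(* Let $\alpha,\beta,\gamma,\delta\in\mathbb{R}$ with $\alpha+\delta\neq0$ and $\alpha\gamma+\beta\delta=0$, and let $(G_5,g,J)$ be the connected, simply connected three-dimensional Lie group with left-invariant Lorentzian metric $g$ whose Lie algebra $\mathfrak{g}$ has a pseudo-orthonormal basis $\{e_1,e_2,e_3\}$ with $e_3$ timelike such that $$[e_1,e_2]=0,\quad [e_1,e_3]=\alpha e_1+\beta e_2,\quad [e_2,e_3]=\gamma e_1+\delta e_2,$$ equipped with the product structure $Je_1=e_1$, $Je_2=e_2$, $Je_3=-e_3$. Let $c\in\mathbb{R}$. Then $(G_5,g,J)$ is a first kind algebraic Wanas soliton associated to the canonical connection $\nabla^0$ with constant $c$ (i.e. $\mathrm{Wan}^0=c\,\mathrm{Id}+D$ with $D$ a derivation of $\mathfrak g$) if and only if $$\alpha^2+\frac{(\beta+\gamma)^2}{2}+\delta^2=c.$$ In particular, in this case $De_1=-\big[\alpha^2+\frac{(\beta+\gamma)^2}{2}+\delta^2\big]e_1$, $De_2=-\big[\alpha^2+\frac{(\beta+\gamma)^2}{2}+\delta^2\big]e_2$, $De_3=0$.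
   Context: Pseudo-orthonormal with $e_3$ timelike means $g(e_1,e_1)=g(e_2,e_2)=1$, $g(e_3,e_3)=-1$, $g(e_i,e_j)=0$ for $i\ne j$. All tensors are left-invariant and evaluated on the Lie algebra $\mathfrak{g}$ of left-invariant vector fields. Let $\nabla$ be the Levi-Civita connection of $g$, and let $J$ be the product structure given in the claim, with $(\nabla_XJ)Y=\nabla_X(JY)-J(\nabla_XY)$. Canonical connection: $\nabla^0_XY=\nabla_XY-\frac12(\nabla_XJ)JY$. Curvature: $R^0(X,Y)Z=\nabla^0_X\nabla^0_YZ-\nabla^0_Y\nabla^0_XZ-\nabla^0_{[X,Y]}Z$. Torsion: $T^0(X,Y)=\nabla^0_XY-\nabla^0_YX-[X,Y]$. $A^0(X,Y)Z=T^0(T^0(X,Y),Z)$, and the Wanas tensor is $W^0(X,Y)Z=R^0(X,Y)Z-A^0(X,Y)Z$. $w^0(X,Y)=-g(W^0(X,e_1)Y,e_1)-g(W^0(X,e_2)Y,e_2)+g(W^0(X,e_3)Y,e_3)$. The operator $\mathrm{Wan}^0:\mathfrak g\to\mathfrak g$ is defined by $w^0(X,Y)=g(\mathrm{Wan}^0(X),Y)$. A derivation of $\mathfrak g$ is a linear map $D$ with $D[X,Y]=[DX,Y]+[X,DY]$ for all $X,Y\in\mathfrak g$. $(G_5,g,J)$ is a first kind algebraic Wanas soliton associated to $\nabla^0$ (with constant $c$) if $\mathrm{Wan}^0=c\,\mathrm{Id}+D$ for the real number $c$ and a derivation $D$ of $\mathfrak g$. *)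

theory Defs
  imports "HOL-Analysis.Linear_Algebra"
begin

text \<open>
  Left-invariant tensors on a Lie group are identified with tensors on its Lie algebra of
  left-invariant vector fields. The Lie algebra is a real vector space with a bracket
  \<open>br\<close>; \<open>g\<close> is the metric and \<open>J\<close> the product structure.
\<close>

definition lie_bracket :: "('a::real_vector \<Rightarrow> 'a \<Rightarrow> 'a) \<Rightarrow> bool" where
  "lie_bracket br \<longleftrightarrow> bilinear br \<and> (\<forall>X. br X X = 0) \<and>
     (\<forall>X Y Z. br X (br Y Z) + br Y (br Z X) + br Z (br X Y) = 0)"

definition derivation :: "('a::real_vector \<Rightarrow> 'a \<Rightarrow> 'a) \<Rightarrow> ('a \<Rightarrow> 'a) \<Rightarrow> bool" where
  "derivation br D \<longleftrightarrow> linear D \<and> (\<forall>X Y. D (br X Y) = br (D X) Y + br X (D Y))"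

definition symmetric_form :: "('a::real_vector \<Rightarrow> 'a \<Rightarrow> real) \<Rightarrow> bool" where
  "symmetric_form g \<longleftrightarrow> bilinear g \<and> (\<forall>X Y. g X Y = g Y X)"

definition pseudo_orthonormal_basis ::
  "('a::real_vector \<Rightarrow> 'a \<Rightarrow> real) \<Rightarrow> 'a \<Rightarrow> 'a \<Rightarrow> 'a \<Rightarrow> bool" where
  "pseudo_orthonormal_basis g e1 e2 e3 \<longleftrightarrow>
     distinct [e1, e2, e3] \<and> independent {e1, e2, e3} \<and> span {e1, e2, e3} = UNIV \<and>
     g e1 e1 = 1 \<and> g e2 e2 = 1 \<and> g e3 e3 = -1 \<and>
     g e1 e2 = 0 \<and> g e1 e3 = 0 \<and> g e2 e3 = 0"

text \<open>
  On left-invariant fields \<open>g Y Z\<close> is a constant function, so its derivative along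
  \<open>X\<close> vanishes; this is why metric compatibility has no derivative term below.
  By the Koszul formula there is exactly one such connection when \<open>g\<close> is nondegenerate
  (in finite dimension).
\<close>

definition is_levi_civita ::
  "('a::real_vector \<Rightarrow> 'a \<Rightarrow> 'a) \<Rightarrow> ('a \<Rightarrow> 'a \<Rightarrow> real) \<Rightarrow> ('a \<Rightarrow> 'a \<Rightarrow> 'a) \<Rightarrow> bool" where
  "is_levi_civita br g nab \<longleftrightarrow> bilinear nab \<and>
     (\<forall>X Y. nab X Y - nab Y X = br X Y) \<and>
     (\<forall>X Y Z. g (nab X Y) Z + g Y (nab X Z) = 0)"

definition levi_civita ::
  "('a::real_vector \<Rightarrow> 'a \<Rightarrow> 'a) \<Rightarrow> ('a \<Rightarrow> 'a \<Rightarrow> real) \<Rightarrow> 'a \<Rightarrow> 'a \<Rightarrow> 'a" where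
  "levi_civita br g = (THE nab. is_levi_civita br g nab)"

definition nabla_J ::
  "('a::real_vector \<Rightarrow> 'a \<Rightarrow> 'a) \<Rightarrow> ('a \<Rightarrow> 'a \<Rightarrow> real) \<Rightarrow> ('a \<Rightarrow> 'a) \<Rightarrow> 'a \<Rightarrow> 'a \<Rightarrow> 'a" where
  "nabla_J br g J X Y = levi_civita br g X (J Y) - J (levi_civita br g X Y)"

definition canonical_connection ::
  "('a::real_vector \<Rightarrow> 'a \<Rightarrow> 'a) \<Rightarrow> ('a \<Rightarrow> 'a \<Rightarrow> real) \<Rightarrow> ('a \<Rightarrow> 'a) \<Rightarrow> 'a \<Rightarrow> 'a \<Rightarrow> 'a" where
  "canonical_connection br g J X Y = levi_civita br g X Y - (1/2) *\<^sub>R nabla_J br g J X (J Y)"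

definition curvature ::
  "('a::real_vector \<Rightarrow> 'a \<Rightarrow> 'a) \<Rightarrow> ('a \<Rightarrow> 'a \<Rightarrow> 'a) \<Rightarrow> 'a \<Rightarrow> 'a \<Rightarrow> 'a \<Rightarrow> 'a" where
  "curvature br nab X Y Z = nab X (nab Y Z) - nab Y (nab X Z) - nab (br X Y) Z"

definition torsion ::
  "('a::real_vector \<Rightarrow> 'a \<Rightarrow> 'a) \<Rightarrow> ('a \<Rightarrow> 'a \<Rightarrow> 'a) \<Rightarrow> 'a \<Rightarrow> 'a \<Rightarrow> 'a" where
  "torsion br nab X Y = nab X Y - nab Y X - br X Y"

definition wanas_tensor ::
  "('a::real_vector \<Rightarrow> 'a \<Rightarrow> 'a) \<Rightarrow> ('a \<Rightarrow> 'a \<Rightarrow> 'a) \<Rightarrow> 'a \<Rightarrow> 'a \<Rightarrow> 'a \<Rightarrow> 'a" where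
  "wanas_tensor br nab X Y Z =
     curvature br nab X Y Z - torsion br nab (torsion br nab X Y) Z"

definition wanas_form ::
  "('a::real_vector \<Rightarrow> 'a \<Rightarrow> 'a) \<Rightarrow> ('a \<Rightarrow> 'a \<Rightarrow> real) \<Rightarrow> ('a \<Rightarrow> 'a) \<Rightarrow> 'a \<Rightarrow> 'a \<Rightarrow> 'a \<Rightarrow>
   'a \<Rightarrow> 'a \<Rightarrow> real" where
  "wanas_form br g J e1 e2 e3 X Y =
     (let W = wanas_tensor br (canonical_connection br g J)
      in - g (W X e1 Y) e1 - g (W X e2 Y) e2 + g (W X e3 Y) e3)"

text \<open>The operator below is unique because \<open>g\<close> is nondegenerate.\<close>

definition wanas_operator ::
  "('a::real_vector \<Rightarrow> 'a \<Rightarrow> 'a) \<Rightarrow> ('a \<Rightarrow> 'a \<Rightarrow> real) \<Rightarrow> ('a \<Rightarrow> 'a) \<Rightarrow> 'a \<Rightarrow> 'a \<Rightarrow> 'a \<Rightarrow>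
   'a \<Rightarrow> 'a" where
  "wanas_operator br g J e1 e2 e3 =
     (THE Wan. \<forall>X Y. wanas_form br g J e1 e2 e3 X Y = g (Wan X) Y)"

definition wanas_soliton_with ::
  "('a::real_vector \<Rightarrow> 'a \<Rightarrow> 'a) \<Rightarrow> ('a \<Rightarrow> 'a \<Rightarrow> real) \<Rightarrow> ('a \<Rightarrow> 'a) \<Rightarrow> 'a \<Rightarrow> 'a \<Rightarrow> 'a \<Rightarrow>
   real \<Rightarrow> ('a \<Rightarrow> 'a) \<Rightarrow> bool" where
  "wanas_soliton_with br g J e1 e2 e3 c D \<longleftrightarrow> derivation br D \<and>
     (\<forall>X. wanas_operator br g J e1 e2 e3 X = c *\<^sub>R X + D X)"

definition first_kind_wanas_soliton ::
  "('a::real_vector \<Rightarrow> 'a \<Rightarrow> 'a) \<Rightarrow> ('a \<Rightarrow> 'a \<Rightarrow> real) \<Rightarrow> ('a \<Rightarrow> 'a) \<Rightarrow> 'a \<Rightarrow> 'a \<Rightarrow> 'a \<Rightarrow>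
   real \<Rightarrow> bool" where
  "first_kind_wanas_soliton br g J e1 e2 e3 c \<longleftrightarrow>
     (\<exists>D. wanas_soliton_with br g J e1 e2 e3 c D)"

end

theory Submission
  imports Defs
begin

text \<open>
  The Levi-Civita connection is read off from the Koszul formula. Passing to the canonical
  connection removes the part of each operator \<open>nab X\<close> that exchanges the eigenspaces of \<open>J\<close>,
  and only the rotation generator \<open>nab e3\<close> of the plane spanned by \<open>e1, e2\<close> survives; as
  brackets have no \<open>e3\<close> component, the canonical connection is flat. Its torsion
  vanishes on the plane and maps \<open>v, e3\<close> to \<open>S v\<close> for the symmetric operator \<open>S\<close> on that plane with \<open>- S e1 = \<alpha> e1 + (\<beta> + \<gamma>)/2 e2\<close> and
  \<open>- S e2 = (\<beta> + \<gamma>)/2 e1 + \<delta> e2\<close>, so the Wanas operator kills \<open>e1, e2\<close>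
  and multiplies \<open>e3\<close> by the trace \<open>K\<close> of the square of \<open>S\<close>. The derivation rule for
  \<open>D = Wan - c Id\<close> on \<open>[e1, e3]\<close> and \<open>[e2, e3]\<close> then forces \<open>(K - c) [ei, e3] = 0\<close>,
  and one of these brackets is nonzero because \<open>\<alpha> + \<delta> \<noteq> 0\<close>.
\<close>

text \<open>Writing each bracket as a difference of covariant derivatives, metric compatibility
  doubles one pair of terms and cancels the others. The right-hand side is free of
  \<open>nab\<close>, which gives uniqueness.\<close>

lemma koszul:
  assumes "symmetric_form g" and "is_levi_civita br g nab"
  shows "2 * g (nab X Y) Z = g (br X Y) Z - g (br Y Z) X + g (br Z X) Y"
proof -
  have bil: "bilinear g" and sym: "\<And>X Y. g X Y = g Y X"
    using assms(1) by (auto simp: symmetric_form_def)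
  have br: "br X Y = nab X Y - nab Y X" and metric: "g (nab X Y) Z = - g (nab X Z) Y" for X Y Z
    using assms(2) sym[of Y "nab X Z"] by (auto simp: is_levi_civita_def add_eq_0_iff)
  show ?thesis
    using metric[of X Y Z] metric[of Y X Z] metric[of Z X Y]
    by (simp add: br bilinear_lsub[OF bil])
qed

lemma levi_civita_eqI:
  assumes "symmetric_form g" and nondeg: "\<And>X Y. (\<And>Z. g X Z = g Y Z) \<Longrightarrow> X = Y"
    and "is_levi_civita br g nab"
  shows "levi_civita br g = nab"
  unfolding levi_civita_def
proof (rule the_equality)
  fix nab' assume "is_levi_civita br g nab'"
  then have "2 * g (nab' X Y) Z = 2 * g (nab X Y) Z" for X Y Z
    by (simp only: koszul[OF assms(1)] koszul[OF assms(1,3)])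
  then show "nab' = nab"
    by (intro ext nondeg) simp
qed (fact assms(3))

lemma wanas_operator_eqI:
  assumes nondeg: "\<And>X Y. (\<And>Z. g X Z = g Y Z) \<Longrightarrow> X = Y"
    and "\<And>X Y. wanas_form br g J e1 e2 e3 X Y = g (Wan X) Y"
  shows "wanas_operator br g J e1 e2 e3 = Wan"
  unfolding wanas_operator_def
proof (rule the_equality)
  fix Wan' assume "\<forall>X Y. wanas_form br g J e1 e2 e3 X Y = g (Wan' X) Y"
  then show "Wan' = Wan"
    by (intro ext nondeg) (simp add: assms(2))
qed (simp add: assms(2))

locale pseudo_orthonormal_frame =
  fixes g :: "'a::real_vector \<Rightarrow> 'a \<Rightarrow> real" and e1 e2 e3 :: 'a
  assumes symmetric_form: "symmetric_form g"
    and pseudo_orthonormal_basis: "pseudo_orthonormal_basis g e1 e2 e3"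
begin

lemma bilinear_g: "bilinear g" and g_commute: "g X Y = g Y X"
  using symmetric_form by (auto simp: symmetric_form_def)

lemmas g_simps [simp] =
  bilinear_ladd[OF bilinear_g] bilinear_radd[OF bilinear_g]
  bilinear_lsub[OF bilinear_g] bilinear_rsub[OF bilinear_g]
  bilinear_lmul[OF bilinear_g] bilinear_rmul[OF bilinear_g]
  bilinear_lneg[OF bilinear_g] bilinear_rneg[OF bilinear_g]
  bilinear_lzero[OF bilinear_g] bilinear_rzero[OF bilinear_g]

lemma g_frame [simp]:
  "g e1 e1 = 1" "g e2 e2 = 1" "g e3 e3 = -1"
  "g e1 e2 = 0" "g e1 e3 = 0" "g e2 e3 = 0" "g e2 e1 = 0" "g e3 e1 = 0" "g e3 e2 = 0"
  using pseudo_orthonormal_basis by (auto simp: pseudo_orthonormal_basis_def g_commute)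

text \<open>The coordinates in the frame; the sign comes from \<open>e3\<close> being timelike.\<close>

definition x1 where "x1 X = g X e1"
definition x2 where "x2 X = g X e2"
definition x3 where "x3 X = - g X e3"

lemmas coord_defs = x1_def x2_def x3_def

lemma expansion: "X = x1 X *\<^sub>R e1 + x2 X *\<^sub>R e2 + x3 X *\<^sub>R e3"
proof -
  have "X \<in> span {e1, e2, e3}"
    using pseudo_orthonormal_basis by (simp add: pseudo_orthonormal_basis_def)
  then obtain a b c where "X - a *\<^sub>R e1 - b *\<^sub>R e2 - c *\<^sub>R e3 = 0"
    by (auto simp: span_insert)
  then have "X = a *\<^sub>R e1 + b *\<^sub>R e2 + c *\<^sub>R e3"
    by (simp add: algebra_simps)
  \<comment> \<open>Pairing the combination with the frame recovers \<open>a\<close>,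
    \<open>b\<close>, \<open>c\<close> as the coordinates.\<close>
  then show ?thesis
    by (simp add: coord_defs)
qed

text \<open>Reduces vector identities to three polynomial identities over the reals.\<close>

lemma coords_eqI: "x1 X = x1 Y \<Longrightarrow> x2 X = x2 Y \<Longrightarrow> x3 X = x3 Y \<Longrightarrow> X = Y"
  by (subst expansion[of X], subst expansion[of Y]) simp

lemma nondegenerate: "(\<And>Z. g X Z = g Y Z) \<Longrightarrow> X = Y"
  by (rule coords_eqI) (simp_all add: coord_defs)

lemma coords_linear [simp]:
  "x1 (X + Y) = x1 X + x1 Y" "x1 (X - Y) = x1 X - x1 Y" "x1 (r *\<^sub>R X) = r * x1 X" "x1 (- X) = - x1 X"
  "x2 (X + Y) = x2 X + x2 Y" "x2 (X - Y) = x2 X - x2 Y" "x2 (r *\<^sub>R X) = r * x2 X" "x2 (- X) = - x2 X"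
  "x3 (X + Y) = x3 X + x3 Y" "x3 (X - Y) = x3 X - x3 Y" "x3 (r *\<^sub>R X) = r * x3 X" "x3 (- X) = - x3 X"
  "x1 0 = 0" "x2 0 = 0" "x3 0 = 0"
  by (simp_all add: coord_defs)

lemma coords_frame [simp]:
  "x1 e1 = 1" "x1 e2 = 0" "x1 e3 = 0"
  "x2 e1 = 0" "x2 e2 = 1" "x2 e3 = 0"
  "x3 e1 = 0" "x3 e2 = 0" "x3 e3 = 1"
  by (simp_all add: coord_defs)

lemma g_coords: "g X Y = x1 X * x1 Y + x2 X * x2 Y - x3 X * x3 Y"
  by (subst expansion[of Y]) (simp add: coord_defs)

end

locale lie_algebra_G5 = pseudo_orthonormal_frame g e1 e2 e3
  for g :: "'a::real_vector \<Rightarrow> 'a \<Rightarrow> real" and e1 e2 e3 :: 'a +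
  fixes \<alpha> \<beta> \<gamma> \<delta> :: real and br :: "'a \<Rightarrow> 'a \<Rightarrow> 'a" and J :: "'a \<Rightarrow> 'a"
  assumes lie_bracket: "lie_bracket br"
    and br_frame: "br e1 e2 = 0" "br e1 e3 = \<alpha> *\<^sub>R e1 + \<beta> *\<^sub>R e2" "br e2 e3 = \<gamma> *\<^sub>R e1 + \<delta> *\<^sub>R e2"
    and linear_J: "linear J"
    and J_frame: "J e1 = e1" "J e2 = e2" "J e3 = - e3"
begin

definition K where "K = \<alpha>\<^sup>2 + (\<beta> + \<gamma>)\<^sup>2 / 2 + \<delta>\<^sup>2"

lemma br_bilinear: "bilinear br" and br_self: "br X X = 0"
  using lie_bracket by (auto simp: lie_bracket_def)

lemma br_antisym: "br X Y = - br Y X"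
proof -
  have "br (X + Y) (X + Y) = br X Y + br Y X"
    by (simp only: bilinear_ladd[OF br_bilinear] bilinear_radd[OF br_bilinear]) (simp add: br_self)
  then show ?thesis
    by (simp only: br_self eq_neg_iff_add_eq_0)
qed

lemma br_frame':
  "br e2 e1 = 0" "br e3 e1 = - (\<alpha> *\<^sub>R e1 + \<beta> *\<^sub>R e2)" "br e3 e2 = - (\<gamma> *\<^sub>R e1 + \<delta> *\<^sub>R e2)"
  using br_antisym[of e2 e1] br_antisym[of e3 e1] br_antisym[of e3 e2] by (simp_all add: br_frame)

lemma br_coords:
  "br X Y = (x1 X * x3 Y - x3 X * x1 Y) *\<^sub>R (\<alpha> *\<^sub>R e1 + \<beta> *\<^sub>R e2)
          + (x2 X * x3 Y - x3 X * x2 Y) *\<^sub>R (\<gamma> *\<^sub>R e1 + \<delta> *\<^sub>R e2)"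
proof -
  have "br X Y = br (x1 X *\<^sub>R e1 + x2 X *\<^sub>R e2 + x3 X *\<^sub>R e3) (x1 Y *\<^sub>R e1 + x2 Y *\<^sub>R e2 + x3 Y *\<^sub>R e3)"
    by (simp only: expansion[symmetric])
  also have "\<dots> = (x1 X * x3 Y - x3 X * x1 Y) *\<^sub>R (\<alpha> *\<^sub>R e1 + \<beta> *\<^sub>R e2)
          + (x2 X * x3 Y - x3 X * x2 Y) *\<^sub>R (\<gamma> *\<^sub>R e1 + \<delta> *\<^sub>R e2)"
    unfolding bilinear_ladd[OF br_bilinear] bilinear_radd[OF br_bilinear]
      bilinear_lmul[OF br_bilinear] bilinear_rmul[OF br_bilinear] br_self br_frame br_frame'
    by (rule coords_eqI) (simp_all add: algebra_simps)
  finally show ?thesis .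
qed

lemma J_coords: "J X = x1 X *\<^sub>R e1 + x2 X *\<^sub>R e2 - x3 X *\<^sub>R e3"
  by (subst expansion[of X]) (simp add: linear_add[OF linear_J] linear_cmul[OF linear_J] J_frame)

text \<open>The Koszul formula solved in the frame: the \<open>e1\<close> and \<open>e2\<close>
  coefficients are half its right-hand side at \<open>Z = e1\<close> and \<open>Z = e2\<close>, the
  \<open>e3\<close> coefficient minus half of it at \<open>Z = e3\<close>.\<close>

definition LC :: "'a \<Rightarrow> 'a \<Rightarrow> 'a" where
  "LC X Y =
     (\<alpha> * x1 X * x3 Y + (\<beta> + \<gamma>) / 2 * x2 X * x3 Y + (\<beta> - \<gamma>) / 2 * x3 X * x2 Y) *\<^sub>R e1
   + ((\<beta> + \<gamma>) / 2 * x1 X * x3 Y + \<delta> * x2 X * x3 Y - (\<beta> - \<gamma>) / 2 * x3 X * x1 Y) *\<^sub>R e2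
   + (\<alpha> * x1 X * x1 Y + (\<beta> + \<gamma>) / 2 * (x1 X * x2 Y + x2 X * x1 Y) + \<delta> * x2 X * x2 Y) *\<^sub>R e3"

lemma is_levi_civita_LC: "is_levi_civita br g LC"
  unfolding is_levi_civita_def
proof (intro conjI allI)
  show "bilinear LC"
    unfolding bilinear_def
    by (intro conjI allI linearI; rule coords_eqI) (simp_all add: LC_def field_simps)
  show "LC X Y - LC Y X = br X Y" for X Y
    by (rule coords_eqI) (simp_all add: LC_def br_coords field_simps)
  show "g (LC X Y) Z + g Y (LC X Z) = 0" for X Y Z
    by (simp add: g_coords LC_def field_simps)
qed

lemma levi_civita_eq: "levi_civita br g = LC"
  by (rule levi_civita_eqI[OF symmetric_form nondegenerate is_levi_civita_LC])

text \<open>Since \<open>J\<close> squares to the identity, the canonical connection is the average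
  of \<open>nab X Y\<close> and \<open>J (nab X (J Y))\<close>, where \<open>nab\<close> is the
  Levi-Civita connection.\<close>

lemma canonical_connection_coords:
  "canonical_connection br g J X Y =
     ((\<beta> - \<gamma>) / 2 * x3 X) *\<^sub>R (x2 Y *\<^sub>R e1 - x1 Y *\<^sub>R e2)"
  by (rule coords_eqI)
    (simp_all add: canonical_connection_def nabla_J_def levi_civita_eq LC_def J_coords field_simps)

text \<open>The operators of the connection are multiples of one rotation generator, so they
  commute; the bracket term vanishes because \<open>x3 (br X Y) = 0\<close>.\<close>

lemma curvature_canonical_connection: "curvature br (canonical_connection br g J) X Y Z = 0"
  by (rule coords_eqI)
    (simp_all add: curvature_def canonical_connection_coords br_coords field_simps)

text \<open>The rotation cancels the skew part of the bracket with \<open>e3\<close>, leaving the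
  symmetric part.\<close>

lemma torsion_canonical_connection:
  "torsion br (canonical_connection br g J) X Y =
     - (x1 X * x3 Y - x3 X * x1 Y) *\<^sub>R (\<alpha> *\<^sub>R e1 + ((\<beta> + \<gamma>) / 2) *\<^sub>R e2)
     - (x2 X * x3 Y - x3 X * x2 Y) *\<^sub>R (((\<beta> + \<gamma>) / 2) *\<^sub>R e1 + \<delta> *\<^sub>R e2)"
  by (rule coords_eqI)
    (simp_all add: torsion_def canonical_connection_coords br_coords field_simps)

text \<open>Torsion values lie in the plane of \<open>e1\<close>, \<open>e2\<close>, so the
  \<open>e3\<close> summand vanishes and the other two add up to a trace.\<close>

lemma wanas_form_coords: "wanas_form br g J e1 e2 e3 X Y = - K * x3 X * x3 Y"
  by (simp add: wanas_form_def Let_def wanas_tensor_def curvature_canonical_connection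
      torsion_canonical_connection K_def field_simps power2_eq_square)

lemma wanas_operator_coords: "wanas_operator br g J e1 e2 e3 X = (K * x3 X) *\<^sub>R e3"
proof -
  \<comment> \<open>The sign of \<open>K\<close> flips because \<open>e3\<close> is
    timelike.\<close>
  have "wanas_operator br g J e1 e2 e3 = (\<lambda>X. (K * x3 X) *\<^sub>R e3)"
    by (rule wanas_operator_eqI[OF nondegenerate]) (simp_all add: wanas_form_coords g_coords)
  then show ?thesis
    by simp
qed

lemma soliton_iff:
  "wanas_soliton_with br g J e1 e2 e3 c D \<longleftrightarrow>
     derivation br D \<and> (\<forall>X. D X = (K * x3 X) *\<^sub>R e3 - c *\<^sub>R X)"
proof -
  have "u = v + w \<longleftrightarrow> w = u - v" for u v w :: 'a
    by auto
  then show ?thesis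
    by (simp only: wanas_soliton_with_def wanas_operator_coords)
qed

lemma soliton_constant:
  assumes "\<alpha> + \<delta> \<noteq> 0" and "wanas_soliton_with br g J e1 e2 e3 c D"
  shows "K = c"
proof -
  have D: "D (br X Y) = br (D X) Y + br X (D Y)" "D X = (K * x3 X) *\<^sub>R e3 - c *\<^sub>R X" for X Y
    using assms(2) by (auto simp: soliton_iff derivation_def)
  \<comment> \<open>The \<open>x1\<close> coordinate isolates the diagonal coefficient:
    \<open>(K - c) * \<alpha> = 0\<close>. Below, \<open>x2\<close> does the same for
    \<open>\<delta>\<close>.\<close>
  have "\<alpha> = 0 \<or> K = c"
    using arg_cong[OF D(1)[of e1 e3], of x1] by (auto simp: D(2) br_coords algebra_simps)
  moreover have "\<delta> = 0 \<or> K = c"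
    using arg_cong[OF D(1)[of e2 e3], of x2] by (auto simp: D(2) br_coords algebra_simps)
  ultimately show ?thesis
    using assms(1) by auto
qed

text \<open>For \<open>c = K\<close> the map kills \<open>e3\<close> and is the scalar
  \<open>- K\<close> on the plane of \<open>e1\<close>, \<open>e2\<close>, an abelian ideal
  containing all brackets; such a map is a derivation.\<close>

lemma soliton_exists: "wanas_soliton_with br g J e1 e2 e3 K (\<lambda>X. (K * x3 X) *\<^sub>R e3 - K *\<^sub>R X)"
  unfolding soliton_iff derivation_def
proof (intro conjI allI)
  show "linear (\<lambda>X. (K * x3 X) *\<^sub>R e3 - K *\<^sub>R X)"
    by (rule linearI) (simp_all add: algebra_simps)
qed (rule coords_eqI; simp add: br_coords algebra_simps)+

end

theorem theorem3p3:
  fixes \<alpha> \<beta> \<gamma> \<delta> c :: real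
    and br :: "'a::real_vector \<Rightarrow> 'a \<Rightarrow> 'a"
    and g :: "'a \<Rightarrow> 'a \<Rightarrow> real"
    and J :: "'a \<Rightarrow> 'a"
    and e1 e2 e3 :: 'a
  assumes "\<alpha> + \<delta> \<noteq> 0" and "\<alpha> * \<gamma> + \<beta> * \<delta> = 0"
    and "lie_bracket br" and "symmetric_form g"
    and "pseudo_orthonormal_basis g e1 e2 e3"
    and "br e1 e2 = 0"
    and "br e1 e3 = \<alpha> *\<^sub>R e1 + \<beta> *\<^sub>R e2"
    and "br e2 e3 = \<gamma> *\<^sub>R e1 + \<delta> *\<^sub>R e2"
    and "linear J" and "J e1 = e1" and "J e2 = e2" and "J e3 = - e3"
  shows "(first_kind_wanas_soliton br g J e1 e2 e3 c \<longleftrightarrow>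
            \<alpha>\<^sup>2 + (\<beta> + \<gamma>)\<^sup>2 / 2 + \<delta>\<^sup>2 = c) \<and>
         (\<forall>D. wanas_soliton_with br g J e1 e2 e3 c D \<longrightarrow>
            D e1 = - (\<alpha>\<^sup>2 + (\<beta> + \<gamma>)\<^sup>2 / 2 + \<delta>\<^sup>2) *\<^sub>R e1 \<and>
            D e2 = - (\<alpha>\<^sup>2 + (\<beta> + \<gamma>)\<^sup>2 / 2 + \<delta>\<^sup>2) *\<^sub>R e2 \<and>
            D e3 = 0)"
proof -
  interpret lie_algebra_G5 g e1 e2 e3 \<alpha> \<beta> \<gamma> \<delta> br J
    by (intro lie_algebra_G5.intro pseudo_orthonormal_frame.intro lie_algebra_G5_axioms.intro assms)
  show ?thesis
    unfolding K_def[symmetric]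
  proof (intro conjI allI impI)
    show "first_kind_wanas_soliton br g J e1 e2 e3 c \<longleftrightarrow> K = c"
      unfolding first_kind_wanas_soliton_def
      using soliton_constant[OF assms(1)] soliton_exists by blast
    fix D assume D: "wanas_soliton_with br g J e1 e2 e3 c D"
    then show "D e1 = - K *\<^sub>R e1" "D e2 = - K *\<^sub>R e2" "D e3 = 0"
      using soliton_constant[OF assms(1) D] by (simp_all add: soliton_iff)
  qed
qed

end
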